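(* Let $M$ be a positive integer and let $a$ and $r$ be nonnegative integers. Put $B_M:=\operatorname{lcm}(1,3,5,\dots,2M-1)$. Then $$\sum_{N=0}^{\infty} p\!\left(\left\lfloor\frac{(2M-1)N}{2}\right\rfloor-(B_M a+r),\,2M-1,\,N\right)z^{N}=\frac{\mathrm{Num}_o(M,r)}{(1-z)\,(z^2;z^2)_{2M-2}},$$ where $$\mathrm{Num}_o(M,r)=\sum_{j=1}^M(-1)^{M-j}\,z^{2B_M a/(2j-1)}\, S_{2j-1}\!\left(z^{\,2r+2\binom{M-j+1}{2}}\,\frac{(1-z^{2j-1})\,\bigl(z^{2(2j-1)};z^{2(2j-1)}\bigr)_{2M-2}}{(1-z)\,(z^4;z^2)_{2M-2}}\begin{bmatrix}2M-1\\ M-j\end{bmatrix}_{z^2}\right).$$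
   Context: For an indeterminate $x$ and a nonnegative integer $k$, $(x;q)_k:=(1-x)(1-xq)\cdots(1-xq^{k-1})$ with $(x;q)_0:=1$. The Gaussian polynomial is $\begin{bmatrix}N+m\\ m\end{bmatrix}_q=\frac{(q;q)_{N+m}}{(q;q)_m(q;q)_N}$ for $m,N\ge0$. For integers $n$ and $m,N\ge0$, $p(n,m,N)$ is the number of partitions of $n$ into at most $m$ parts, each part at most $N$; equivalently the coefficient of $q^n$ in $\begin{bmatrix}N+m\\ m\end{bmatrix}_q$ (it is $0$ for $n<0$). For a polynomial $P(z)=\sum_{i=0}^d a_iz^i$ and positive integer $s$, $(S_sP)(z):=\sum_{i=0}^{\lfloor d/s\rfloor}a_{is}z^i$ (the expression inside $S_{2j-1}$ above is a polynomial in $z$). *)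

theory Defs
  imports Complex_Main "HOL-Library.Multiset" "HOL-Computational_Algebra.Computational_Algebra"
begin

definition qpoch :: "'a::comm_ring_1 \<Rightarrow> 'a \<Rightarrow> nat \<Rightarrow> 'a" where
  "qpoch x q k = (\<Prod>i<k. 1 - x * q ^ i)"

text \<open>The Gaussian polynomial with top \<open>n\<close> and bottom \<open>m \<le> n\<close>, evaluated at \<open>q\<close>.
  The division is exact by \<open>qpoch_mult_dvd\<close>.\<close>

definition qbinom :: "rat poly \<Rightarrow> nat \<Rightarrow> nat \<Rightarrow> rat poly" where
  "qbinom q n m = qpoch q q n div (qpoch q q m * qpoch q q (n - m))"

text \<open>Partitions are multisets of positive integers; the first argument is an integer so that
  the count is \<open>0\<close> for negative \<open>n\<close>.\<close>

definition partitions_count :: "int \<Rightarrow> nat \<Rightarrow> nat \<Rightarrow> nat" where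
  "partitions_count n m N =
     card {\<mu> :: nat multiset. int (sum_mset \<mu>) = n \<and> size \<mu> \<le> m \<and> (\<forall>x\<in>#\<mu>. 1 \<le> x \<and> x \<le> N)}"

definition odd_lcm :: "nat \<Rightarrow> nat" where
  "odd_lcm M = Lcm {2 * i - 1 | i. i \<in> {1..M}}"

definition dissect :: "nat \<Rightarrow> 'a::comm_monoid_add poly \<Rightarrow> 'a poly" where
  "dissect s P = (\<Sum>i = 0..degree P div s. monom (coeff P (i * s)) i)"

text \<open>The indeterminate \<open>z\<close> to the power \<open>k\<close> is \<open>monom 1 k\<close>.  The Gaussian factor is put into
  the numerator because the quotient of the other factors need not be a polynomial on its own;
  the division below is exact by \<open>num_term_exact\<close>.\<close>

definition num_term :: "nat \<Rightarrow> nat \<Rightarrow> nat \<Rightarrow> rat poly" where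
  "num_term M r j =
     (monom 1 (2 * r + 2 * ((M - j + 1) choose 2)) * (1 - monom 1 (2 * j - 1))
        * qpoch (monom 1 (2 * (2 * j - 1))) (monom 1 (2 * (2 * j - 1))) (2 * M - 2)
        * qbinom (monom 1 2) (2 * M - 1) (M - j))
     div ((1 - monom 1 1) * qpoch (monom 1 4) (monom 1 2) (2 * M - 2))"

definition num_odd :: "nat \<Rightarrow> nat \<Rightarrow> nat \<Rightarrow> rat poly" where
  "num_odd M a r =
     (\<Sum>j = 1..M. (-1) ^ (M - j) * monom 1 (2 * odd_lcm M * a div (2 * j - 1))
                  * dissect (2 * j - 1) (num_term M r j))"

lemma odd_dvd_odd_lcm:
  assumes "j \<in> {1..M}"
  shows "2 * j - 1 dvd 2 * odd_lcm M * a"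
proof -
  have "2 * j - 1 dvd odd_lcm M"
    unfolding odd_lcm_def using assms by (intro dvd_Lcm) auto
  then show ?thesis by (simp add: mult.assoc dvd_mult dvd_mult2)
qed

lemma qpoch_0 [simp]: "qpoch x q 0 = 1"
  by (simp add: qpoch_def)

lemma qpoch_Suc: "qpoch x q (Suc k) = qpoch x q k * (1 - x * q ^ k)"
  by (simp add: qpoch_def)

lemma qpoch_mult_dvd:
  fixes q :: "'a::comm_ring_1"
  shows "qpoch q q m * qpoch q q n dvd qpoch q q (m + n)"
proof (induction "m + n" arbitrary: m n)
  case 0
  then show ?case by simp
next
  case (Suc s)
  show ?case
  proof (cases "m = 0 \<or> n = 0")
    case True
    then show ?thesis by auto
  next
    case False
    then obtain m' n' where mn: "m = Suc m'" "n = Suc n'"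
      by (metis not0_implies_Suc)
    have 1: "qpoch q q m' * qpoch q q n dvd qpoch q q s"
      using Suc.hyps(1)[of m' n] Suc.hyps(2) mn by auto
    have 2: "qpoch q q m * qpoch q q n' dvd qpoch q q s"
      using Suc.hyps(1)[of m n'] Suc.hyps(2) mn by auto
    have s: "s = m' + Suc n'" using Suc.hyps(2) mn by auto
    have "qpoch q q (m + n) = qpoch q q (Suc s)" using Suc.hyps(2) by simp
    also have "\<dots> = qpoch q q s * (1 - q ^ Suc m')
                     + q ^ Suc m' * (qpoch q q s * (1 - q ^ Suc n'))"
      unfolding qpoch_Suc s by (simp add: algebra_simps power_add)
    finally have eq: "qpoch q q (m + n) = qpoch q q s * (1 - q ^ Suc m')
                     + q ^ Suc m' * (qpoch q q s * (1 - q ^ Suc n'))" .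
    have d1: "qpoch q q m * qpoch q q n dvd qpoch q q s * (1 - q ^ Suc m')"
      using mult_dvd_mono[OF 1 dvd_refl[of "1 - q ^ Suc m'"]] mn
      by (simp add: qpoch_Suc ac_simps)
    have d2: "qpoch q q m * qpoch q q n dvd qpoch q q s * (1 - q ^ Suc n')"
      using mult_dvd_mono[OF 2 dvd_refl[of "1 - q ^ Suc n'"]] mn
      by (simp add: qpoch_Suc ac_simps)
    show ?thesis unfolding eq by (intro dvd_add dvd_mult d1 d2)
  qed
qed

lemma one_minus_power_dvd:
  fixes q :: "'a::comm_ring_1"
  assumes "m dvd n"
  shows "1 - q ^ m dvd 1 - q ^ n"
proof -
  obtain k where "n = m * k" using assms by auto
  then have "1 - q ^ n = 1 ^ k - (q ^ m) ^ k" by (simp add: power_mult)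
  then show ?thesis
    by (metis dvd_triv_left power_diff_sumr2)
qed

lemma dvd_one_minus_gcd:
  fixes q :: "'a::comm_ring_1"
  assumes "x dvd (1 - q ^ b) * y" "x dvd (1 - q ^ c) * y"
  shows "x dvd (1 - q ^ gcd b c) * y"
  using assms
proof (induction b c rule: gcd_nat_induct)
  case (base m)
  then show ?case by simp
next
  case (step m n)
  have eq: "1 - q ^ (m mod n) = (1 - q ^ m) - (1 - q ^ (n * (m div n)))
              + (1 - q ^ (n * (m div n))) * (1 - q ^ (m mod n))"
    by (simp add: algebra_simps flip: power_add)
  have d: "x dvd (1 - q ^ (n * (m div n))) * y"
    by (rule dvd_trans[OF step.prems(2)]) (intro mult_dvd_mono one_minus_power_dvd; simp)
  have "(1 - q ^ (m mod n)) * y = (1 - q ^ m) * y - (1 - q ^ (n * (m div n))) * y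
          + (1 - q ^ (n * (m div n))) * y * (1 - q ^ (m mod n))"
    by (subst eq) (simp add: algebra_simps)
  then have "x dvd (1 - q ^ (m mod n)) * y"
    using d step.prems(1) by (metis dvd_add dvd_diff dvd_mult2)
  then show ?case
    using step by (simp add: gcd_red_nat[of m n])
qed

lemma qpoch_Suc_left: "qpoch x q (Suc k) = (1 - x) * qpoch (x * q) q k"
  unfolding qpoch_def by (subst prod.lessThan_Suc_shift) (simp add: ac_simps)

lemma qpoch_quotient_dvd:
  fixes q G :: "'a::idom"
  assumes nz: "\<And>i. 0 < i \<Longrightarrow> q ^ i \<noteq> 1"
    and G: "G * (qpoch q q c * qpoch q q b) = qpoch q q (c + b)"
    and b: "b = c + k" "0 < k"
  shows "qpoch (q ^ 2) q (c + b - 1) dvd qpoch (q ^ k) (q ^ k) (c + b - 1) * G"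
proof (cases "c + b = 1")
  case True
  then show ?thesis by simp
next
  case False
  then obtain s where s: "c + b = Suc (Suc s)" using b
    by (metis One_nat_def add_is_0 not0_implies_Suc less_numeral_extra(3))
  have qnz: "qpoch q q i \<noteq> 0" for i
    unfolding qpoch_def using nz[of "Suc i" for i] by simp
  have key: "1 - q ^ (c + b) dvd (1 - q ^ v) * G"
    if v: "u + v = c + b" "G * (qpoch q q u * qpoch q q v) = qpoch q q (c + b)" for u v
  proof (cases v)
    case 0
    then show ?thesis by simp
  next
    case (Suc w)
    obtain H where H: "qpoch q q (u + w) = qpoch q q u * qpoch q q w * H"
      using qpoch_mult_dvd[of q u w] by (auto simp: dvd_def)
    have uw: "c + b = Suc (u + w)" using v Suc by simp
    have "(qpoch q q u * qpoch q q w) * ((1 - q ^ v) * G)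
            = (qpoch q q u * qpoch q q w) * ((1 - q ^ (c + b)) * H)"
      using v(2) H unfolding uw Suc qpoch_Suc by (simp add: algebra_simps)
    then have "(1 - q ^ v) * G = (1 - q ^ (c + b)) * H"
      using qnz by simp
    then show ?thesis by simp
  qed
  have "1 - q ^ (c + b) dvd (1 - q ^ gcd b c) * G"
  proof (rule dvd_one_minus_gcd)
    show "1 - q ^ (c + b) dvd (1 - q ^ b) * G" by (rule key[of c]) (use G in auto)
    show "1 - q ^ (c + b) dvd (1 - q ^ c) * G" by (rule key[of b]) (use G in \<open>auto simp: ac_simps\<close>)
  qed
  also have "\<dots> dvd (1 - q ^ k) * G"
    using b by (intro mult_dvd_mono one_minus_power_dvd)
      (auto simp: gcd.commute)
  finally have 1: "1 - q ^ (c + b) dvd (1 - q ^ k) * G" .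
  have 2: "qpoch (q ^ 2) q s dvd qpoch (q ^ k * q ^ k) (q ^ k) s"
    unfolding qpoch_def
  proof (rule prod_dvd_prod)
    fix i
    have "1 - q ^ (2 + i) dvd 1 - q ^ (k * (2 + i))"
      by (rule one_minus_power_dvd) (rule dvd_triv_right)
    also have "q ^ (k * (2 + i)) = q ^ k * q ^ k * (q ^ k) ^ i"
      by (simp add: algebra_simps flip: power_add power_mult)
    finally show "1 - q ^ 2 * q ^ i dvd 1 - q ^ k * q ^ k * (q ^ k) ^ i"
      by (simp only: power_add)
  qed
  have L: "qpoch (q ^ 2) q (c + b - 1) = qpoch (q ^ 2) q s * (1 - q ^ (c + b))"
    unfolding s by (simp add: qpoch_Suc power2_eq_square mult.assoc)
  have R: "qpoch (q ^ k) (q ^ k) (c + b - 1) * G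
             = qpoch (q ^ k * q ^ k) (q ^ k) s * ((1 - q ^ k) * G)"
    unfolding s by (simp add: qpoch_Suc_left ac_simps)
  show ?thesis unfolding L R using mult_dvd_mono[OF 2 1] by simp
qed

lemma num_term_exact:
  assumes "j \<in> {1..M}"
  shows "(1 - monom 1 1) * qpoch (monom 1 4) (monom 1 2) (2 * M - 2) dvd
     (monom 1 (2 * r + 2 * ((M - j + 1) choose 2)) * (1 - monom 1 (2 * j - 1))
        * qpoch (monom 1 (2 * (2 * j - 1))) (monom 1 (2 * (2 * j - 1))) (2 * M - 2)
        * qbinom (monom 1 2) (2 * M - 1) (M - j))"
proof -
  define q :: "rat poly" where "q = monom 1 2"
  define k where "k = 2 * j - 1"
  have M: "2 * M - 1 = (M - j) + (M + j - 1)" "2 * M - 1 - (M - j) = M + j - 1"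
    "2 * M - 2 = (M - j) + (M + j - 1) - 1" "M + j - 1 = (M - j) + k" "0 < k"
    using assms by (auto simp: k_def)
  have q: "q ^ i = monom 1 (2 * i)" for i
    by (simp add: q_def monom_power)
  have nz: "q ^ i \<noteq> 1" if "0 < i" for i
  proof
    assume "q ^ i = 1"
    then have "degree (q ^ i) = degree (1 :: rat poly)" by simp
    then show False using that by (simp add: q degree_monom_eq)
  qed
  have G: "qbinom q (2 * M - 1) (M - j) * (qpoch q q (M - j) * qpoch q q (M + j - 1))
             = qpoch q q ((M - j) + (M + j - 1))"
    using qpoch_mult_dvd[of q "M - j" "M + j - 1"]
    unfolding qbinom_def M(2) unfolding M(1) by (rule dvd_div_mult_self)
  have A: "qpoch (q ^ 2) q (2 * M - 2) dvd
             qpoch (q ^ k) (q ^ k) (2 * M - 2) * qbinom q (2 * M - 1) (M - j)"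
    unfolding M(3) by (rule qpoch_quotient_dvd[OF nz G M(4,5)])
  have B: "(1 - monom 1 1 :: rat poly) dvd 1 - monom 1 k"
    using one_minus_power_dvd[of 1 k "monom 1 1 :: rat poly"] by (simp add: monom_power)
  have "(1 - monom 1 1) * qpoch (q ^ 2) q (2 * M - 2) dvd
          (1 - monom 1 k) * (qpoch (q ^ k) (q ^ k) (2 * M - 2) * qbinom q (2 * M - 1) (M - j))"
    by (rule mult_dvd_mono[OF B A])
  then show ?thesis
    unfolding q k_def[symmetric] q_def[symmetric] by (simp add: mult.assoc dvd_mult)
qed

end

theory Submission
  imports Defs
begin

text \<open>Write \<open>m = 2M - 1\<close> and \<open>L = B\<^sub>M a + r\<close>.  Replacing \<open>q\<close> by \<open>z\<^sup>2\<close> in the Gaussian polynomial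
  and multiplying by \<open>1 + z\<close> removes the floor: the number of partitions in question is the
  coefficient of \<open>z ^ (m N)\<close> in \<open>z ^ (2 L) (1 + z)\<close> times the Gaussian polynomial.  The
  \<open>q\<close>-binomial theorem expands the latter as a sum over \<open>k \<le> m\<close> in which \<open>N\<close> enters only through
  a factor \<open>z ^ (2 N k)\<close>.  Hence the \<open>k\<close>-th summand contributes the coefficient of
  \<open>z ^ ((m - 2 k) N)\<close> of a series independent of \<open>N\<close>: nothing for \<open>k \<ge> M\<close>, and for \<open>k = M - j\<close> a
  dissection modulo \<open>2 j - 1\<close>.  Clearing denominators before dissecting gives the numerator.\<close>

section \<open>Gaussian polynomials\<close>

text \<open>The \<open>q\<close>-Pascal recurrence is free of division, so one definition serves
  polynomials and power series alike.\<close>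

fun gauss :: "'a::comm_ring_1 \<Rightarrow> nat \<Rightarrow> nat \<Rightarrow> 'a" where
  "gauss q n 0 = 1"
| "gauss q 0 (Suc k) = 0"
| "gauss q (Suc n) (Suc k) = q ^ Suc k * gauss q n (Suc k) + gauss q n k"

lemma gauss_eq_0: "n < k \<Longrightarrow> gauss q n k = 0"
  by (induction q n k rule: gauss.induct) auto

lemma gauss_self [simp]: "gauss q n n = 1"
  by (induction n) (auto simp: gauss_eq_0)

text \<open>Pascal's rule reduces the claim to 1 - q^(a+b) = q^a (1 - q^b) + (1 - q^a).\<close>

lemma gauss_mult_qpoch:
  "gauss q (a + b) a * (qpoch q q a * qpoch q q b) = qpoch q q (a + b)"
proof (induction "a + b" arbitrary: a b)
  case 0
  then show ?case by simp
next
  case (Suc s)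
  show ?case
  proof (cases "a = 0 \<or> b = 0")
    case True
    then show ?thesis by auto
  next
    case False
    then obtain c d where cd: "a = Suc c" "b = Suc d"
      by (metis not0_implies_Suc)
    have 1: "gauss q s a * (qpoch q q a * qpoch q q d) = qpoch q q s"
      using Suc.hyps(1)[of a d] Suc.hyps(2) cd by simp
    have 2: "gauss q s c * (qpoch q q c * qpoch q q b) = qpoch q q s"
      using Suc.hyps(1)[of c b] Suc.hyps(2) cd by simp
    have s: "a + b = Suc s" "s = c + Suc d" using Suc.hyps(2) cd by auto
    have "gauss q (a + b) a * (qpoch q q a * qpoch q q b)
        = q ^ Suc c * (1 - q * q ^ d) * (gauss q s a * (qpoch q q a * qpoch q q d))
          + (1 - q * q ^ c) * (gauss q s c * (qpoch q q c * qpoch q q b))"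
      unfolding s(1) by (simp add: cd qpoch_Suc algebra_simps)
    also have "\<dots> = qpoch q q s * (1 - q * q ^ s)"
      unfolding 1 2 by (simp add: s(2) algebra_simps power_add)
    finally show ?thesis by (simp add: s(1) qpoch_Suc)
  qed
qed

lemma Suc_choose_2: "Suc k choose 2 = (k choose 2) + k"
  by (simp add: numeral_2_eq_2)

text \<open>Induction with \<open>x\<close> arbitrary: split off the first factor 1 - x, use the
  hypothesis at \<open>x * q\<close>, and let Pascal's rule merge the two contributions to each
  power of \<open>x\<close>.\<close>

theorem q_binomial:
  "qpoch x q n = (\<Sum>k\<le>n. (-1) ^ k * q ^ (k choose 2) * gauss q n k * x ^ k)"
proof (induction n arbitrary: x)
  case 0
  then show ?case by (simp add: binomial_eq_0)
next
  case (Suc n)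
  \<comment> \<open>Passing from \<open>x\<close> to \<open>x * q\<close> contributes q^k, which
    raises \<open>k choose 2\<close> to \<open>Suc k choose 2\<close>.\<close>
  define t where "t k = (-1) ^ k * q ^ (Suc k choose 2) * x ^ k" for k
  have e: "qpoch (x * q) q n = (\<Sum>k\<le>n. t k * gauss q n k)"
    unfolding Suc.IH t_def Suc_choose_2 by (rule sum.cong) (auto simp: power_mult_distrib power_add)
  \<comment> \<open>The added term vanishes; it lets the sum shifted by one run over the same range
    as the unshifted one.\<close>
  have "(\<Sum>k\<le>n. t k * gauss q n k) = (\<Sum>k\<le>Suc n. t k * gauss q n k)"
    by (simp add: gauss_eq_0)
  also have "\<dots> = 1 + (\<Sum>k\<le>n. t (Suc k) * gauss q n (Suc k))"
    by (subst sum.atMost_Suc_shift) (simp add: t_def binomial_eq_0)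
  finally have f: "qpoch (x * q) q n = 1 + (\<Sum>k\<le>n. t (Suc k) * gauss q n (Suc k))"
    using e by simp
  have "qpoch x q (Suc n) = qpoch (x * q) q n - x * qpoch (x * q) q n"
    by (simp add: qpoch_Suc_left algebra_simps)
  also have "\<dots> = 1 + (\<Sum>k\<le>n. t (Suc k) * gauss q n (Suc k) - x * (t k * gauss q n k))"
    by (subst f, subst e) (simp add: sum_subtractf sum_distrib_left)
  also have "\<dots> = 1 + (\<Sum>k\<le>n. (-1) ^ Suc k * q ^ (Suc k choose 2) * gauss q (Suc n) (Suc k) * x ^ Suc k)"
    by (intro arg_cong2[where f = "(+)"] refl sum.cong)
       (simp add: t_def Suc_choose_2[of "Suc k" for k] algebra_simps power_add)
  also have "\<dots> = (\<Sum>k\<le>Suc n. (-1) ^ k * q ^ (k choose 2) * gauss q (Suc n) k * x ^ k)"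
    by (subst sum.atMost_Suc_shift) (simp add: binomial_eq_0)
  finally show ?case .
qed

text \<open>Since \<open>d\<close> is positive, no positive power of the base is 1, so the divisor
  in \<open>qbinom\<close> is nonzero and can be cancelled.\<close>

lemma qbinom_eq_gauss:
  assumes "k \<le> n" "0 < d"
  shows "qbinom (monom 1 d) n k = gauss (monom 1 d) n k"
proof -
  let ?q = "monom 1 d :: rat poly"
  have "?q ^ Suc i \<noteq> 1" for i
  proof
    assume "?q ^ Suc i = 1"
    then have "degree (?q ^ Suc i) = degree (1 :: rat poly)" by simp
    then show False using assms(2) by (simp add: monom_power degree_monom_eq del: power_Suc)
  qed
  then have nz: "qpoch ?q ?q i \<noteq> 0" for i
    unfolding qpoch_def by (simp add: eq_commute[of 1])
  have "gauss ?q n k * (qpoch ?q ?q k * qpoch ?q ?q (n - k)) = qpoch ?q ?q n"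
    using gauss_mult_qpoch[of ?q k "n - k"] assms(1) by simp
  then show ?thesis
    unfolding qbinom_def using nz by (metis mult_eq_0_iff nonzero_mult_div_cancel_right)
qed

section \<open>Partitions in a box\<close>

definition box_partitions :: "nat \<Rightarrow> nat \<Rightarrow> nat multiset set" where
  "box_partitions m N = {\<mu>. size \<mu> \<le> m \<and> (\<forall>x\<in>#\<mu>. 1 \<le> x \<and> x \<le> N)}"

lemma box_partitions_0_left [simp]: "box_partitions 0 N = {{#}}"
  by (auto simp: box_partitions_def)

lemma box_partitions_0_right [simp]: "box_partitions m 0 = {{#}}"
proof -
  have "\<mu> = {#}" if "\<mu> \<in> box_partitions m 0" for \<mu>
    using that by (cases \<mu>) (auto simp: box_partitions_def)
  then show ?thesis by (auto simp: box_partitions_def)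
qed

text \<open>Either the part \<open>Suc N\<close> is absent, or one copy of it can be
  removed.\<close>

lemma box_partitions_Suc:
  "box_partitions (Suc m) (Suc N)
     = box_partitions (Suc m) N \<union> add_mset (Suc N) ` box_partitions m (Suc N)"
proof (intro equalityI subsetI)
  fix \<mu> assume \<mu>: "\<mu> \<in> box_partitions (Suc m) (Suc N)"
  show "\<mu> \<in> box_partitions (Suc m) N \<union> add_mset (Suc N) ` box_partitions m (Suc N)"
  proof (cases "Suc N \<in># \<mu>")
    case True
    then obtain \<nu> where "\<mu> = add_mset (Suc N) \<nu>" by (metis mset_add)
    then show ?thesis using \<mu> by (auto simp: box_partitions_def)
  next
    case False
    then show ?thesis using \<mu> by (force simp: box_partitions_def le_Suc_eq)
  qed
qed (auto simp: box_partitions_def le_Suc_eq)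

lemma finite_box_partitions: "finite (box_partitions m N)"
proof (induction "m + N" arbitrary: m N rule: less_induct)
  case less
  then show ?case
    by (cases m; cases N) (simp_all add: box_partitions_Suc)
qed

lemma sum_box_partitions_Suc:
  fixes q :: "'a::comm_ring_1"
  shows "(\<Sum>\<mu>\<in>box_partitions (Suc m) (Suc N). q ^ sum_mset \<mu>)
     = (\<Sum>\<mu>\<in>box_partitions (Suc m) N. q ^ sum_mset \<mu>)
       + q ^ Suc N * (\<Sum>\<mu>\<in>box_partitions m (Suc N). q ^ sum_mset \<mu>)"
proof -
  have "box_partitions (Suc m) N \<inter> add_mset (Suc N) ` box_partitions m (Suc N) = {}"
    by (auto simp: box_partitions_def)
  moreover have "(\<Sum>\<mu>\<in>add_mset (Suc N) ` box_partitions m (Suc N). q ^ sum_mset \<mu>)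
      = q ^ Suc N * (\<Sum>\<mu>\<in>box_partitions m (Suc N). q ^ sum_mset \<mu>)"
    by (subst sum.reindex) (simp_all add: power_add sum_distrib_left mult.assoc inj_on_def)
  ultimately show ?thesis
    unfolding box_partitions_Suc by (simp add: sum.union_disjoint finite_box_partitions)
qed

text \<open>The sum is a Gaussian polynomial. In this product form \<open>N\<close> survives only in
  the first argument on the right, ready for \<open>q_binomial\<close>.\<close>

lemma box_partitions_gf:
  fixes q :: "'a::comm_ring_1"
  shows "(\<Sum>\<mu>\<in>box_partitions m N. q ^ sum_mset \<mu>) * qpoch q q m = qpoch (q ^ Suc N) q m"
proof (induction "m + N" arbitrary: m N rule: less_induct)
  case less
  show ?case
  proof (cases "m = 0 \<or> N = 0")
    case True
    then show ?thesis by auto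
  next
    case False
    then obtain m' N' where mN: "m = Suc m'" "N = Suc N'"
      by (metis not0_implies_Suc)
    have 1: "(\<Sum>\<mu>\<in>box_partitions m N'. q ^ sum_mset \<mu>) * qpoch q q m = qpoch (q ^ Suc N') q m"
      by (rule less) (simp add: mN)
    have 2: "(\<Sum>\<mu>\<in>box_partitions m' N. q ^ sum_mset \<mu>) * qpoch q q m' = qpoch (q ^ Suc N) q m'"
      by (rule less) (simp add: mN)
    have "(\<Sum>\<mu>\<in>box_partitions m N. q ^ sum_mset \<mu>) * qpoch q q m
        = (\<Sum>\<mu>\<in>box_partitions m N'. q ^ sum_mset \<mu>) * qpoch q q m
          + q ^ N * (1 - q * q ^ m') * ((\<Sum>\<mu>\<in>box_partitions m' N. q ^ sum_mset \<mu>) * qpoch q q m')"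
      by (simp add: mN sum_box_partitions_Suc qpoch_Suc algebra_simps)
    also have "\<dots> = (1 - q ^ N) * qpoch (q ^ Suc N) q m'
          + q ^ N * (1 - q * q ^ m') * qpoch (q ^ Suc N) q m'"
      unfolding 1 2 by (simp add: mN qpoch_Suc_left mult.commute)
    also have "\<dots> = qpoch (q ^ Suc N) q m"
      by (simp add: mN qpoch_Suc algebra_simps)
    finally show ?thesis .
  qed
qed

text \<open>A partition of \<open>s\<close> contributes to the exponents 2s and 2s+1, precisely
  those whose half rounds down to \<open>s\<close>.\<close>

lemma fps_nth_box_partitions:
  "((1 + fps_X) * (\<Sum>\<mu>\<in>box_partitions m N. (fps_X ^ 2) ^ sum_mset \<mu>) :: 'a::comm_ring_1 fps) $ i
     = of_nat (partitions_count (int (i div 2)) m N)"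
proof -
  have pc: "{\<mu> :: nat multiset. int (sum_mset \<mu>) = int n \<and> size \<mu> \<le> m \<and> (\<forall>x\<in>#\<mu>. 1 \<le> x \<and> x \<le> N)}
      = box_partitions m N \<inter> {\<mu>. sum_mset \<mu> = n}" for n
    unfolding of_nat_eq_iff box_partitions_def by auto
  have "((1 + fps_X) * (fps_X ^ 2) ^ s :: 'a fps) $ i = (if s = i div 2 then 1 else 0)" for s
  proof -
    have "((1 + fps_X) * (fps_X ^ 2) ^ s :: 'a fps) = fps_X ^ (2 * s) + fps_X ^ Suc (2 * s)"
      by (simp add: algebra_simps flip: power_mult)
    then have "((1 + fps_X) * (fps_X ^ 2) ^ s :: 'a fps) $ i
        = (if i = 2 * s then 1 else 0) + (if i = Suc (2 * s) then 1 else 0)"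
      by (simp only: fps_add_nth fps_X_power_nth)
    also have "\<dots> = (if s = i div 2 then 1 else 0)" by auto
    finally show ?thesis .
  qed
  then have "((1 + fps_X) * (\<Sum>\<mu>\<in>box_partitions m N. (fps_X ^ 2) ^ sum_mset \<mu>) :: 'a fps) $ i
      = (\<Sum>\<mu>\<in>box_partitions m N. if sum_mset \<mu> = i div 2 then 1 else 0)"
    by (simp add: sum_distrib_left fps_sum_nth)
  also have "\<dots> = of_nat (partitions_count (int (i div 2)) m N)"
    unfolding partitions_count_def pc
    by (simp add: finite_box_partitions sum.If_cases)
  finally show ?thesis .
qed

section \<open>Dissection of power series\<close>

definition fps_dissect :: "nat \<Rightarrow> 'a fps \<Rightarrow> 'a fps" where
  "fps_dissect s f = Abs_fps (\<lambda>n. f $ (s * n))"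

lemma fps_dissect_nth [simp]: "fps_dissect s f $ n = f $ (s * n)"
  by (simp add: fps_dissect_def)

lemma fps_of_poly_dissect:
  assumes "0 < s"
  shows "fps_of_poly (dissect s P) = fps_dissect s (fps_of_poly P)"
proof (rule fps_ext)
  fix n
  \<comment> \<open>Cutting the sum in \<open>dissect\<close> at the degree loses no
    coefficient.\<close>
  have "coeff P (n * s) = 0" if "degree P div s < n"
    using that assms by (intro coeff_eq_0) (simp add: div_less_iff_less_mult)
  then have "coeff (dissect s P) n = coeff P (n * s)"
    by (auto simp: dissect_def coeff_sum coeff_monom)
  then show "fps_of_poly (dissect s P) $ n = fps_dissect s (fps_of_poly P) $ n"
    by (simp add: mult.commute)
qed

text \<open>Dissection is linear over series in z^s: such a factor comes out with z^s replaced by z.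
  This is the monomial case.\<close>

lemma fps_dissect_X_power_mult:
  fixes f :: "'a::comm_ring_1 fps"
  assumes "0 < s"
  shows "fps_dissect s (fps_X ^ (s * t) * f) = fps_X ^ t * fps_dissect s f"
  using assms by (intro fps_ext) (simp add: fps_X_power_mult_nth diff_mult_distrib2)

lemma fps_dissect_one_minus_mult:
  fixes f :: "'a::comm_ring_1 fps"
  assumes "0 < s"
  shows "fps_dissect s ((1 - fps_X ^ (s * t)) * f) = (1 - fps_X ^ t) * fps_dissect s f"
proof -
  have "fps_dissect s (f - g) = fps_dissect s f - fps_dissect s g" for g
    by (rule fps_ext) simp
  then show ?thesis
    using fps_dissect_X_power_mult[OF assms, of t f] by (simp add: left_diff_distrib)
qed

lemma fps_dissect_qpoch_mult:
  fixes f :: "'a::comm_ring_1 fps"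
  assumes "0 < s"
  shows "fps_dissect s (qpoch (fps_X ^ (s * c)) (fps_X ^ (s * d)) k * f)
     = qpoch (fps_X ^ c) (fps_X ^ d) k * fps_dissect s f"
proof (induction k arbitrary: f)
  case 0
  then show ?case by simp
next
  case (Suc k)
  have e: "fps_X ^ (s * c) * (fps_X ^ (s * d)) ^ k = (fps_X :: 'a fps) ^ (s * (c + d * k))"
    "fps_X ^ c * (fps_X ^ d) ^ k = (fps_X :: 'a fps) ^ (c + d * k)"
    by (simp_all add: algebra_simps flip: power_mult power_add)
  show ?case
    unfolding qpoch_Suc e mult.assoc Suc.IH fps_dissect_one_minus_mult[OF assms] ..
qed

section \<open>The generating function\<close>

lemma fps_neg_one_power_mult_nth:
  fixes f :: "'a::comm_ring_1 fps"
  shows "((-1) ^ k * f) $ i = (-1) ^ k * (f $ i)"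
  by (cases "even k") simp_all

lemma fps_of_poly_qpoch: "fps_of_poly (qpoch x q k) = qpoch (fps_of_poly x) (fps_of_poly q) k"
  by (induction k) (simp_all add: qpoch_Suc fps_of_poly_mult fps_of_poly_diff fps_of_poly_power)

lemma fps_of_poly_gauss: "fps_of_poly (gauss q n k) = gauss (fps_of_poly q) n k"
  by (induction q n k rule: gauss.induct)
     (simp_all add: fps_of_poly_add fps_of_poly_mult fps_of_poly_power)

lemma fps_of_poly_monom_one: "fps_of_poly (monom 1 k) = (fps_X ^ k :: 'a::comm_ring_1 fps)"
  by (simp add: fps_of_poly_monom)

definition num_den :: "nat \<Rightarrow> rat fps" where
  "num_den M = (1 - fps_X) * qpoch (fps_X ^ 4) (fps_X ^ 2) (2 * M - 2)"

lemma qpoch_fps_nth_0: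
  assumes "0 < c"
  shows "qpoch (fps_X ^ c) q k $ 0 = (1 :: 'a::comm_ring_1)"
  using assms by (induction k) (simp_all add: qpoch_Suc)

lemma num_den_nth_0: "num_den M $ 0 = 1"
  by (simp add: num_den_def qpoch_fps_nth_0)

text \<open>Exactness of the division in \<open>num_term\<close> turns the quotient into a product
  identity, which carries over to power series.\<close>

lemma num_term_mult_num_den:
  assumes "j \<in> {1..M}"
  shows "fps_of_poly (num_term M r j) * num_den M
     = fps_X ^ (2 * r + 2 * ((M - j + 1) choose 2)) * (1 - fps_X ^ (2 * j - 1))
        * qpoch (fps_X ^ (2 * (2 * j - 1))) (fps_X ^ (2 * (2 * j - 1))) (2 * M - 2)
        * gauss (fps_X ^ 2) (2 * M - 1) (M - j)"
proof -
  have qb: "qbinom (monom 1 2) (2 * M - 1) (M - j) = gauss (monom 1 2) (2 * M - 1) (M - j)"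
    by (rule qbinom_eq_gauss) auto
  have den: "num_den M
      = fps_of_poly ((1 - monom 1 1) * qpoch (monom 1 4) (monom 1 2) (2 * M - 2))"
    by (simp add: num_den_def fps_of_poly_mult fps_of_poly_diff fps_of_poly_qpoch
        fps_of_poly_monom_one del: fps_of_poly_monom)
  show ?thesis
    unfolding den num_term_def fps_of_poly_mult[symmetric] dvd_div_mult_self[OF num_term_exact[OF assms]]
    by (simp only: qb fps_of_poly_mult fps_of_poly_diff fps_of_poly_qpoch fps_of_poly_gauss
        fps_of_poly_monom_one fps_of_poly_1)
qed

text \<open>The denominator comes from \<open>(1 + z) / (z\<^sup>2; z\<^sup>2)\<^sub>m = 1 / ((1 - z) (z\<^sup>4; z\<^sup>2)\<^sub>m\<^sub>-\<^sub>1)\<close>.\<close>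

definition summand :: "nat \<Rightarrow> nat \<Rightarrow> nat \<Rightarrow> rat fps" where
  "summand M L k =
     fps_X ^ (2 * L + 2 * (Suc k choose 2)) * gauss (fps_X ^ 2) (2 * M - 1) k * inverse (num_den M)"

text \<open>With q = z^2 and m = 2M - 1, multiplying by \<open>num_den M\<close> turns the left side
  into z^(2L) (q^(N+1); q)_m, and \<open>q_binomial\<close> applies at x = q^(N+1).\<close>

lemma box_partitions_expansion:
  assumes "0 < M"
  shows "fps_X ^ (2 * L) * ((1 + fps_X) * (\<Sum>\<mu>\<in>box_partitions (2 * M - 1) N. (fps_X ^ 2) ^ sum_mset \<mu>))
     = (\<Sum>k\<le>2 * M - 1. (-1) ^ k * (fps_X ^ (2 * N * k) * summand M L k))"
proof -
  define m where "m = 2 * M - 1"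
  define W :: "rat fps" where "W = (\<Sum>\<mu>\<in>box_partitions m N. (fps_X ^ 2) ^ sum_mset \<mu>)"
  define q :: "rat fps" where "q = fps_X ^ 2"
  have q4: "q * q = fps_X ^ 4" by (simp add: q_def flip: power_add)
  have m: "m = Suc (2 * M - 2)" using assms by (simp add: m_def)
  have den: "(1 + fps_X) * num_den M = qpoch q q m"
  proof -
    have "(1 + fps_X) * (1 - fps_X) = 1 - q"
      by (simp add: q_def algebra_simps power2_eq_square)
    then show ?thesis
      unfolding m qpoch_Suc_left q4 num_den_def q_def[symmetric] by (simp only: flip: mult.assoc)
  qed
  have "(1 + fps_X) * num_den M * W = qpoch (q ^ Suc N) q m"
    using box_partitions_gf[of q m N] unfolding den W_def q_def by (simp only: mult.commute)
  also have "\<dots> = (\<Sum>k\<le>m. (-1) ^ k * q ^ (k choose 2) * gauss q m k * (q ^ Suc N) ^ k)"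
    by (rule q_binomial)
  finally have E: "(1 + fps_X) * num_den M * W
      = (\<Sum>k\<le>m. (-1) ^ k * q ^ (k choose 2) * gauss q m k * (q ^ Suc N) ^ k)" .
  have inv: "num_den M * inverse (num_den M) = 1"
    by (simp add: num_den_nth_0 inverse_mult_eq_1')
  have "fps_X ^ (2 * L) * ((1 + fps_X) * W)
      = fps_X ^ (2 * L) * (((1 + fps_X) * num_den M * W) * inverse (num_den M))"
  proof -
    have "(1 + fps_X) * num_den M * W * inverse (num_den M)
        = (1 + fps_X) * W * (num_den M * inverse (num_den M))"
      by (simp only: ac_simps)
    then show ?thesis unfolding inv by simp
  qed
  also have "\<dots> = (\<Sum>k\<le>m. fps_X ^ (2 * L)
      * ((-1) ^ k * q ^ (k choose 2) * gauss q m k * (q ^ Suc N) ^ k * inverse (num_den M)))"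
    unfolding E by (simp add: sum_distrib_left sum_distrib_right)
  also have "\<dots> = (\<Sum>k\<le>m. (-1) ^ k * (fps_X ^ (2 * N * k) * summand M L k))"
  proof (rule sum.cong)
    fix k
    \<comment> \<open>One factor q^k of \<open>(q ^ Suc N) ^ k\<close> raises
      \<open>k choose 2\<close> to \<open>Suc k choose 2\<close>; the remaining q^(Nk) is
      z^(2Nk).\<close>
    have "fps_X ^ (2 * N * k) * (fps_X :: rat fps) ^ (2 * L + 2 * (Suc k choose 2))
        = fps_X ^ (2 * L) * q ^ (k choose 2) * (q ^ Suc N) ^ k"
      unfolding q_def Suc_choose_2 power_mult[symmetric] power_add[symmetric]
      by (simp add: algebra_simps)
    then show "fps_X ^ (2 * L)
        * ((-1) ^ k * q ^ (k choose 2) * gauss q m k * (q ^ Suc N) ^ k * inverse (num_den M))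
        = (-1) ^ k * (fps_X ^ (2 * N * k) * summand M L k)"
      unfolding summand_def m_def[symmetric] q_def[symmetric] by (simp add: ac_simps)
  qed simp
  finally show ?thesis unfolding W_def m_def .
qed

lemma partitions_count_eq_sum:
  assumes "0 < M"
  shows "of_nat (partitions_count (\<lfloor>real ((2 * M - 1) * N) / 2\<rfloor> - int L) (2 * M - 1) N)
     = (\<Sum>j = 1..M. (-1) ^ (M - j) * (summand M L (M - j) $ ((2 * j - 1) * N)))"
proof -
  define m where "m = 2 * M - 1"
  define W :: "rat fps" where "W = (\<Sum>\<mu>\<in>box_partitions m N. (fps_X ^ 2) ^ sum_mset \<mu>)"
  have fl: "\<lfloor>real (m * N) / 2\<rfloor> = int (m * N div 2)"
    using floor_divide_of_nat_eq[of "m * N" 2, where ?'a = real] by simp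
  have "of_nat (partitions_count (\<lfloor>real (m * N) / 2\<rfloor> - int L) m N)
      = (fps_X ^ (2 * L) * ((1 + fps_X) * W)) $ (m * N)"
  proof (cases "m * N < 2 * L")
    \<comment> \<open>The number to be partitioned is negative and the shift by \<open>2 * L\<close>
      overshoots, so both sides are 0.\<close>
    case True
    then have "m * N div 2 < L" by simp
    then have "int n \<noteq> int (m * N div 2) - int L" for n by linarith
    then have "partitions_count (int (m * N div 2) - int L) m N = 0"
      unfolding partitions_count_def by (simp only: simp_thms Collect_empty_eq card.empty empty_def[symmetric])
    then show ?thesis
      using True unfolding fl by (simp add: fps_X_power_mult_nth)
  next
    case False
    \<comment> \<open>Subtracting an even number commutes with rounding down the half, whatever the
      parity of \<open>m * N\<close>.\<close>
    then have "(m * N - 2 * L) div 2 = m * N div 2 - L" "L \<le> m * N div 2" by auto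
    then have "int (m * N div 2) - int L = int ((m * N - 2 * L) div 2)" by simp
    then show ?thesis
      using False unfolding fl W_def fps_X_power_mult_nth fps_nth_box_partitions by simp
  qed
  also have "\<dots> = (\<Sum>k\<le>m. (-1) ^ k * (fps_X ^ (2 * N * k) * summand M L k)) $ (m * N)"
    using box_partitions_expansion[OF assms, of L N] unfolding W_def m_def by simp
  also have "\<dots> = (\<Sum>k\<le>m. (-1) ^ k * ((fps_X ^ (2 * N * k) * summand M L k) $ (m * N)))"
    by (simp only: fps_sum_nth fps_neg_one_power_mult_nth)
  also have "\<dots> = (\<Sum>k<M. (-1) ^ k * ((fps_X ^ (2 * N * k) * summand M L k) $ (m * N)))"
  proof (rule sum.mono_neutral_right)
    show "\<forall>k\<in>{..m} - {..<M}. (-1) ^ k * ((fps_X ^ (2 * N * k) * summand M L k) $ (m * N)) = 0"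
    proof
      fix k assume "k \<in> {..m} - {..<M}"
      then have k: "m + 1 \<le> 2 * k" "0 < k" using assms by (auto simp: m_def)
      have "m * N \<le> (2 * k) * N" using k(1) by (intro mult_le_mono1) simp
      \<comment> \<open>This supplies the strict inequality when \<open>N = 0\<close>, where both
        multiples of \<open>N\<close> vanish.\<close>
      moreover have "0 < Suc k choose 2" using k(2) by simp
      ultimately have "m * N < 2 * N * k + (2 * L + 2 * (Suc k choose 2))"
        unfolding mult.assoc[of 2 N] mult.assoc[of 2 k] mult.commute[of N k] by linarith
      moreover have "fps_X ^ (2 * N * k) * summand M L k
          = fps_X ^ (2 * N * k + (2 * L + 2 * (Suc k choose 2)))
            * (gauss (fps_X ^ 2) (2 * M - 1) k * inverse (num_den M))"
        unfolding summand_def power_add by (simp only: mult.assoc)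
      ultimately show "(-1) ^ k * ((fps_X ^ (2 * N * k) * summand M L k) $ (m * N)) = 0"
        by (simp only: fps_X_power_mult_nth) simp
    qed
  qed (use assms in \<open>auto simp: m_def\<close>)
  also have "\<dots> = (\<Sum>k<M. (-1) ^ k * (summand M L k $ ((2 * (M - k) - 1) * N)))"
  proof (intro sum.cong refl)
    fix k assume "k \<in> {..<M}"
    then have "m = 2 * k + (2 * (M - k) - 1)" by (auto simp: m_def)
    then have "m * N = 2 * N * k + (2 * (M - k) - 1) * N"
      by (metis add_mult_distrib mult.assoc mult.commute)
    then show "(-1) ^ k * ((fps_X ^ (2 * N * k) * summand M L k) $ (m * N))
        = (-1) ^ k * (summand M L k $ ((2 * (M - k) - 1) * N))"
      by (simp add: fps_X_power_mult_nth)
  qed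
  also have "\<dots> = (\<Sum>j = 1..M. (-1) ^ (M - j) * (summand M L (M - j) $ ((2 * j - 1) * N)))"
    by (rule sum.reindex_bij_witness[of _ "\<lambda>j. M - j" "\<lambda>k. M - k"]) auto
  finally show ?thesis unfolding m_def .
qed

text \<open>With s = 2j - 1, multiplying the summand by (1 - z^s) (z^(2s); z^(2s))_(2M-2) before
  dissecting leaves a polynomial. These factors come out as the common denominator, independent of
  \<open>j\<close>.\<close>

lemma dissect_num_term:
  assumes "j \<in> {1..M}"
  shows "(1 - fps_X) * qpoch (fps_X ^ 2) (fps_X ^ 2) (2 * M - 2)
       * fps_dissect (2 * j - 1) (summand M (odd_lcm M * a + r) (M - j))
     = fps_X ^ (2 * odd_lcm M * a div (2 * j - 1))
       * fps_of_poly (dissect (2 * j - 1) (num_term M r j))"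
proof -
  define s where "s = 2 * j - 1"
  define t where "t = 2 * odd_lcm M * a div s"
  have s: "0 < s" using assms by (auto simp: s_def)
  \<comment> \<open>Here the least common multiple matters: z^(2 B_M a) is a power of z^s for every
    \<open>j\<close>, so it too passes through the dissection.\<close>
  have t: "s * t = 2 * odd_lcm M * a"
    using odd_dvd_odd_lcm[OF assms, of a] by (simp add: s_def t_def)
  define S where "S = summand M (odd_lcm M * a + r) (M - j)"
  define Q :: "rat fps" where "Q = qpoch (fps_X ^ (s * 2)) (fps_X ^ (s * 2)) (2 * M - 2)"
  have inv: "num_den M * inverse (num_den M) = 1"
    by (simp add: num_den_nth_0 inverse_mult_eq_1')
  have T: "fps_of_poly (num_term M r j) * num_den M
      = fps_X ^ (2 * r + 2 * (Suc (M - j) choose 2)) * (1 - fps_X ^ s) * Q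
        * gauss (fps_X ^ 2) (2 * M - 1) (M - j)"
    using num_term_mult_num_den[OF assms, of r] unfolding Q_def s_def
    by (simp only: mult.commute[of 2] Suc_eq_plus1)
  have "fps_of_poly (num_term M r j) = fps_of_poly (num_term M r j) * num_den M * inverse (num_den M)"
    by (simp only: mult.assoc inv mult_1_right)
  moreover have "(fps_X :: rat fps) ^ (2 * (odd_lcm M * a + r) + 2 * (Suc (M - j) choose 2))
      = fps_X ^ (s * t) * fps_X ^ (2 * r + 2 * (Suc (M - j) choose 2))"
    unfolding t power_add[symmetric] by (simp add: algebra_simps)
  ultimately have "fps_X ^ (s * t) * fps_of_poly (num_term M r j) = (1 - fps_X ^ (s * 1)) * (Q * S)"
    unfolding T S_def summand_def by (simp add: ac_simps)
  then have "fps_X ^ t * fps_dissect s (fps_of_poly (num_term M r j))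
      = fps_dissect s ((1 - fps_X ^ (s * 1)) * (Q * S))"
    using fps_dissect_X_power_mult[OF s] by metis
  also have "\<dots> = (1 - fps_X) * qpoch (fps_X ^ 2) (fps_X ^ 2) (2 * M - 2) * fps_dissect s S"
    unfolding fps_dissect_one_minus_mult[OF s] Q_def fps_dissect_qpoch_mult[OF s]
    by (simp add: mult.assoc)
  finally show ?thesis
    unfolding s_def[symmetric] t_def[symmetric] S_def[symmetric] fps_of_poly_dissect[OF s] by simp
qed

theorem theorem2p4:
  fixes M a r :: nat
  assumes "0 < M"
  shows "Abs_fps (\<lambda>N. of_nat (partitions_count
            (\<lfloor>real ((2 * M - 1) * N) / 2\<rfloor> - int (odd_lcm M * a + r)) (2 * M - 1) N))
         = (fps_of_poly (num_odd M a r)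
            / ((1 - fps_X) * qpoch (fps_X ^ 2) (fps_X ^ 2) (2 * M - 2)) :: rat fps)"
proof -
  define P :: "rat fps" where "P = (1 - fps_X) * qpoch (fps_X ^ 2) (fps_X ^ 2) (2 * M - 2)"
  define A :: "rat fps" where "A = Abs_fps (\<lambda>N. of_nat (partitions_count
            (\<lfloor>real ((2 * M - 1) * N) / 2\<rfloor> - int (odd_lcm M * a + r)) (2 * M - 1) N))"
  let ?D = "\<lambda>j. fps_dissect (2 * j - 1) (summand M (odd_lcm M * a + r) (M - j))"
  have A: "A = (\<Sum>j = 1..M. (-1) ^ (M - j) * ?D j)"
    by (rule fps_ext) (simp only: A_def fps_nth_Abs_fps partitions_count_eq_sum[OF assms]
        fps_sum_nth fps_neg_one_power_mult_nth fps_dissect_nth)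
  have "A * P = (\<Sum>j = 1..M. (-1) ^ (M - j) * (P * ?D j))"
    unfolding A by (simp add: sum_distrib_right mult.assoc mult.commute[of P])
  also have "\<dots> = (\<Sum>j = 1..M. (-1) ^ (M - j) * (fps_X ^ (2 * odd_lcm M * a div (2 * j - 1))
       * fps_of_poly (dissect (2 * j - 1) (num_term M r j))))"
    by (intro sum.cong refl) (simp only: P_def dissect_num_term)
  also have "\<dots> = fps_of_poly (num_odd M a r)"
    unfolding num_odd_def
    by (simp only: fps_of_poly_sum fps_of_poly_mult fps_of_poly_power fps_of_poly_uminus
        fps_of_poly_1 fps_of_poly_monom_one mult.assoc)
  finally have "fps_of_poly (num_odd M a r) = A * P" ..
  \<comment> \<open>The constant term of \<open>P\<close> is 1, so dividing \<open>A * P\<close> by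
    \<open>P\<close> gives back \<open>A\<close>.\<close>
  moreover have "P \<noteq> 0"
  proof
    assume "P = 0"
    then have "P $ 0 = 0" by simp
    then show False by (simp add: P_def qpoch_fps_nth_0)
  qed
  ultimately have "A = fps_of_poly (num_odd M a r) / P" by simp
  then show ?thesis unfolding A_def P_def .
qed

end
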